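(* Let $H$ be a complex Hilbert space, let $m\in\mathbb{Z}_{1}$ and let $A_{1},\ldots,A_{m}\in\mathbf{B}(H)$ be invertible operators. Then there exists an $(m+2)$-isometric unilateral weighted shift $S\in\mathbf{B}(\ell^{2}(\mathbb{N},H))$ with weights $(S_{j})_{j\in\mathbb{Z}_{1}}\subset\mathbf{B}(H)$ such that $S_{j}=A_{j}$ for every $j=1,\ldots,m$ and such that $S_{j}$ is positive for every $j\in\mathbb{Z}_{m+1}$.
   Context: $\mathbb{N}$ is the set of non-negative integers and $\mathbb{Z}_{p}=\{n\in\mathbb{Z}: n\ge p\}$. $\mathbf{B}(H)$ is the algebra of bounded linear operators on a complex Hilbert space $H$; invertible means invertible in $\mathbf{B}(H)$. An operator $T\in\mathbf{B}(H)$ is called positive if $\langle Tf,f\rangle>0$ for every $f\in H$, $f\neq 0$. $\ell^{2}(\mathbb{N},H)$ is the Hilbert space of square-summable sequences $(h_{i})_{i\in\mathbb{N}}$ in $H$. For a uniformly bounded sequence $(S_{i})_{i\in\mathbb{Z}_{1}}\subset\mathbf{B}(H)$, the unilateral weighted shift $S$ with weights $(S_{i})_{i\in\mathbb{Z}_{1}}$ is the bounded operator on $\ell^{2}(\mathbb{N},H)$ given by $S(h_{0},h_{1},\ldots)=(0,S_{1}h_{0},S_{2}h_{1},\ldots)$. A bounded operator $T$ is $m$-isometric ($m\in\mathbb{Z}_{1}$) if $\sum_{k=0}^{m}\binom{m}{k}(-1)^{m-k}T^{*k}T^{k}=0$. *)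

theory Defs
  imports "HOL-Analysis.Analysis" "HOL-Library.Complex_Order"
begin

section \<open>Complex Hilbert spaces\<close>

text \<open>
  The library only has real inner product spaces. A complex inner product space is taken to be a
  real one, together with a complex scaling extending the real one and a sesquilinear form
  (linear in the first argument) whose real part is the given real inner product. Since
  \<open>norm x = sqrt (inner x x)\<close> in \<^class>\<open>real_inner\<close>, the norm is the usual one,
  and definiteness of the form is inherited from \<^class>\<open>real_inner\<close>.
\<close>

class complex_inner = real_inner +
  fixes scaleC :: "complex \<Rightarrow> 'a \<Rightarrow> 'a"  (infixr "*\<^sub>C" 75)
    and cinner :: "'a \<Rightarrow> 'a \<Rightarrow> complex"
  assumes scaleC_add_right: "a *\<^sub>C (x + y) = a *\<^sub>C x + a *\<^sub>C y"
    and scaleC_add_left: "(a + b) *\<^sub>C x = a *\<^sub>C x + b *\<^sub>C x"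
    and scaleC_scaleC: "a *\<^sub>C b *\<^sub>C x = (a * b) *\<^sub>C x"
    and scaleC_of_real: "complex_of_real r *\<^sub>C x = r *\<^sub>R x"
    and cinner_commute: "cinner x y = cnj (cinner y x)"
    and cinner_add_left: "cinner (x + y) z = cinner x z + cinner y z"
    and cinner_scaleC_left: "cinner (a *\<^sub>C x) y = a * cinner x y"
    and Re_cinner: "Re (cinner x y) = inner x y"

class chilbert_space = complex_inner + complete_space
begin
subclass banach ..
end

lemma cinner_same: "cinner x x = complex_of_real ((norm x)\<^sup>2)"
  for x :: "'a::complex_inner"
proof -
  have "Im (cinner x x) = 0"
    using arg_cong[OF cinner_commute[of x x], of Im] by simp
  then show ?thesis
    by (simp add: complex_eq_iff Re_cinner power2_norm_eq_inner)
qed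

lemma Im_cinner: "Im (cinner x y) = - inner (\<i> *\<^sub>C x) y"
  for x :: "'a::complex_inner"
  using Re_cinner[of "\<i> *\<^sub>C x" y] by (simp add: cinner_scaleC_left)

lemma norm_scaleC: "norm (a *\<^sub>C x) = cmod a * norm x"
  for x :: "'a::complex_inner"
proof -
  have "cinner (a *\<^sub>C x) (a *\<^sub>C x) = a * cnj a * cinner x x"
    by (metis cinner_commute cinner_scaleC_left complex_cnj_mult mult.assoc mult.left_commute)
  also have "\<dots> = complex_of_real ((cmod a * norm x)\<^sup>2)"
    by (simp add: cinner_same power_mult_distrib complex_norm_square[symmetric])
  finally have "(norm (a *\<^sub>C x))\<^sup>2 = (cmod a * norm x)\<^sup>2"
    unfolding cinner_same of_real_eq_iff .
  then show ?thesis by simp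
qed

section \<open>Bounded operators\<close>

definition bounded_clinear :: "('a::complex_inner \<Rightarrow> 'a) \<Rightarrow> bool" where
  "bounded_clinear T \<longleftrightarrow> bounded_linear T \<and> (\<forall>a x. T (a *\<^sub>C x) = a *\<^sub>C T x)"

definition invertible_op :: "('a::complex_inner \<Rightarrow> 'a) \<Rightarrow> bool" where
  "invertible_op T \<longleftrightarrow> bounded_clinear T \<and>
     (\<exists>R. bounded_clinear R \<and> R \<circ> T = id \<and> T \<circ> R = id)"

text \<open>
  The order on \<^typ>\<open>complex\<close> is the one in which \<open>0 < z\<close> means that \<open>z\<close> is
  real and strictly positive.
\<close>

definition positive_op :: "('a::complex_inner \<Rightarrow> 'a) \<Rightarrow> bool" where
  "positive_op T \<longleftrightarrow> bounded_clinear T \<and> (\<forall>f. f \<noteq> 0 \<longrightarrow> 0 < cinner (T f) f)"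

text \<open>
  For \<open>bounded_clinear T\<close> on a Hilbert space, exactly one such \<open>R\<close> exists by the
  Riesz representation theorem; for other \<open>T\<close> the value is unspecified.
\<close>

definition cadjoint :: "('a::chilbert_space \<Rightarrow> 'a) \<Rightarrow> 'a \<Rightarrow> 'a" where
  "cadjoint T = (THE R. bounded_clinear R \<and> (\<forall>f g. cinner (T f) g = cinner f (R g)))"

definition m_isometric :: "nat \<Rightarrow> ('a::chilbert_space \<Rightarrow> 'a) \<Rightarrow> bool" where
  "m_isometric m T \<longleftrightarrow> bounded_clinear T \<and>
     (\<forall>f. (\<Sum>k\<le>m. (of_nat (m choose k) * (-1) ^ (m - k)) *\<^sub>C (cadjoint T ^^ k) ((T ^^ k) f)) = 0)"

section \<open>Square-summable sequences\<close>

typedef (overloaded) 'a ell2 = "{h :: nat \<Rightarrow> 'a::complex_inner. summable (\<lambda>i. (norm (h i))\<^sup>2)}"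
  morphisms component Abs_ell2
  by (rule exI[of _ "\<lambda>_. 0"]) simp

setup_lifting type_definition_ell2

lemma summable_sq_add:
  fixes f g :: "nat \<Rightarrow> 'a::complex_inner"
  assumes "summable (\<lambda>i. (norm (f i))\<^sup>2)" "summable (\<lambda>i. (norm (g i))\<^sup>2)"
  shows "summable (\<lambda>i. (norm (f i + g i))\<^sup>2)"
proof (rule summable_comparison_test')
  show "summable (\<lambda>i. 2 * (norm (f i))\<^sup>2 + 2 * (norm (g i))\<^sup>2)"
    using assms by (intro summable_add summable_mult)
  fix i
  have "(norm (f i + g i))\<^sup>2 \<le> (norm (f i) + norm (g i))\<^sup>2"
    by (simp add: norm_triangle_ineq power_mono)
  also have "\<dots> \<le> 2 * (norm (f i))\<^sup>2 + 2 * (norm (g i))\<^sup>2"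
    using sum_squares_bound[of "norm (f i)" "norm (g i)"] by (simp add: power2_sum)
  finally show "norm ((norm (f i + g i))\<^sup>2) \<le> 2 * (norm (f i))\<^sup>2 + 2 * (norm (g i))\<^sup>2"
    by simp
qed

lemma summable_sq_inner:
  fixes f g :: "nat \<Rightarrow> 'a::complex_inner"
  assumes "summable (\<lambda>i. (norm (f i))\<^sup>2)" "summable (\<lambda>i. (norm (g i))\<^sup>2)"
  shows "summable (\<lambda>i. inner (f i) (g i))"
proof (rule summable_comparison_test')
  show "summable (\<lambda>i. (norm (f i))\<^sup>2 + (norm (g i))\<^sup>2)"
    using assms by (intro summable_add)
  fix i
  have "\<bar>inner (f i) (g i)\<bar> \<le> norm (f i) * norm (g i)"
    by (rule Cauchy_Schwarz_ineq2)
  also have "\<dots> \<le> (norm (f i))\<^sup>2 + (norm (g i))\<^sup>2"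
    using sum_squares_bound[of "norm (f i)" "norm (g i)"]
      mult_nonneg_nonneg[OF norm_ge_zero norm_ge_zero, of "f i" "g i"] by linarith
  finally show "norm (inner (f i) (g i)) \<le> (norm (f i))\<^sup>2 + (norm (g i))\<^sup>2"
    by simp
qed

lemma summable_sq_scaleC:
  fixes f :: "nat \<Rightarrow> 'a::complex_inner"
  assumes "summable (\<lambda>i. (norm (f i))\<^sup>2)"
  shows "summable (\<lambda>i. (norm (a *\<^sub>C f i))\<^sup>2)"
  using summable_mult[OF assms, of "(cmod a)\<^sup>2"] by (simp add: norm_scaleC power_mult_distrib)

lemma summable_sq_cinner:
  fixes f g :: "nat \<Rightarrow> 'a::complex_inner"
  assumes "summable (\<lambda>i. (norm (f i))\<^sup>2)" "summable (\<lambda>i. (norm (g i))\<^sup>2)"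
  shows "summable (\<lambda>i. cinner (f i) (g i))"
  unfolding summable_complex_iff Re_cinner Im_cinner
  using assms by (intro conjI summable_sq_inner summable_minus summable_sq_scaleC)

instantiation ell2 :: (complex_inner) complex_inner
begin

lift_definition zero_ell2 :: "'a ell2" is "\<lambda>_. 0" by simp
lift_definition plus_ell2 :: "'a ell2 \<Rightarrow> 'a ell2 \<Rightarrow> 'a ell2" is "\<lambda>f g i. f i + g i"
  by (rule summable_sq_add)
lift_definition uminus_ell2 :: "'a ell2 \<Rightarrow> 'a ell2" is "\<lambda>f i. - f i" by simp
lift_definition minus_ell2 :: "'a ell2 \<Rightarrow> 'a ell2 \<Rightarrow> 'a ell2" is "\<lambda>f g i. f i - g i"
  subgoal for f g using summable_sq_add[of f "\<lambda>i. - g i"] by simp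
  done
lift_definition scaleR_ell2 :: "real \<Rightarrow> 'a ell2 \<Rightarrow> 'a ell2" is "\<lambda>r f i. r *\<^sub>R f i"
  using summable_sq_scaleC[of _ "complex_of_real _"] by (simp add: scaleC_of_real)
lift_definition scaleC_ell2 :: "complex \<Rightarrow> 'a ell2 \<Rightarrow> 'a ell2" is "\<lambda>a f i. a *\<^sub>C f i"
  by (rule summable_sq_scaleC)
lift_definition inner_ell2 :: "'a ell2 \<Rightarrow> 'a ell2 \<Rightarrow> real" is "\<lambda>f g. \<Sum>i. inner (f i) (g i)" .
lift_definition cinner_ell2 :: "'a ell2 \<Rightarrow> 'a ell2 \<Rightarrow> complex" is "\<lambda>f g. \<Sum>i. cinner (f i) (g i)" .

definition norm_ell2 :: "'a ell2 \<Rightarrow> real" where "norm_ell2 f = sqrt (inner f f)"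
definition sgn_ell2 :: "'a ell2 \<Rightarrow> 'a ell2" where "sgn_ell2 f = inverse (norm f) *\<^sub>R f"
definition dist_ell2 :: "'a ell2 \<Rightarrow> 'a ell2 \<Rightarrow> real" where "dist_ell2 f g = norm (f - g)"
definition uniformity_ell2 :: "('a ell2 \<times> 'a ell2) filter" where
  "uniformity_ell2 = (INF e\<in>{0<..}. principal {(x, y). dist x y < e})"
definition open_ell2 :: "'a ell2 set \<Rightarrow> bool" where
  "open_ell2 U = (\<forall>x\<in>U. eventually (\<lambda>(x', y). x' = x \<longrightarrow> y \<in> U) uniformity)"

instance
proof
  fix f g h :: "'a ell2" and r s :: real and a b :: complex and U :: "'a ell2 set"
  show "f + g + h = f + (g + h)" by transfer (simp add: add.assoc)
  show "f + g = g + f" by transfer (simp add: add.commute)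
  show "0 + f = f" by transfer simp
  show "- f + f = 0" by transfer simp
  show "f - g = f + - g" by transfer simp
  show "r *\<^sub>R (f + g) = r *\<^sub>R f + r *\<^sub>R g" by transfer (simp add: scaleR_add_right)
  show "(r + s) *\<^sub>R f = r *\<^sub>R f + s *\<^sub>R f" by transfer (simp add: scaleR_add_left)
  show "r *\<^sub>R s *\<^sub>R f = (r * s) *\<^sub>R f" by transfer simp
  show "1 *\<^sub>R f = f" by transfer simp
  show "sgn f = inverse (norm f) *\<^sub>R f" by (rule sgn_ell2_def)
  show "dist f g = norm (f - g)" by (rule dist_ell2_def)
  show "(uniformity :: ('a ell2 \<times> 'a ell2) filter) = (INF e\<in>{0<..}. principal {(x, y). dist x y < e})"
    by (rule uniformity_ell2_def)
  show "open U = (\<forall>x\<in>U. eventually (\<lambda>(x', y). x' = x \<longrightarrow> y \<in> U) uniformity)"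
    by (rule open_ell2_def)
  show "inner f g = inner g f" by transfer (simp add: inner_commute)
  show "inner (f + g) h = inner f h + inner g h"
    by transfer (simp add: inner_add_left suminf_add summable_sq_inner)
  show "inner (r *\<^sub>R f) g = r * inner f g"
    by transfer (simp add: suminf_mult summable_sq_inner)
  show "0 \<le> inner f f"
    by transfer (auto intro!: suminf_nonneg summable_sq_inner)
  show "inner f f = 0 \<longleftrightarrow> f = 0"
    by transfer (auto simp: fun_eq_iff suminf_eq_zero_iff summable_sq_inner)
  show "norm f = sqrt (inner f f)" by (rule norm_ell2_def)
  show "a *\<^sub>C (f + g) = a *\<^sub>C f + a *\<^sub>C g" by transfer (simp add: scaleC_add_right)
  show "(a + b) *\<^sub>C f = a *\<^sub>C f + b *\<^sub>C f" by transfer (simp add: scaleC_add_left)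
  show "a *\<^sub>C b *\<^sub>C f = (a * b) *\<^sub>C f" by transfer (simp add: scaleC_scaleC)
  show "complex_of_real r *\<^sub>C f = r *\<^sub>R f" by transfer (simp add: scaleC_of_real)
  show "cinner f g = cnj (cinner g f)"
  proof transfer
    fix f g :: "nat \<Rightarrow> 'a"
    assume "summable (\<lambda>i. (norm (f i))\<^sup>2)" "summable (\<lambda>i. (norm (g i))\<^sup>2)"
    then have "(\<lambda>i. cinner (g i) (f i)) sums (\<Sum>i. cinner (g i) (f i))"
      by (intro summable_sums summable_sq_cinner)
    then have "(\<lambda>i. cinner (f i) (g i)) sums cnj (\<Sum>i. cinner (g i) (f i))"
      by (subst cinner_commute) (simp only: sums_cnj)
    then show "(\<Sum>i. cinner (f i) (g i)) = cnj (\<Sum>i. cinner (g i) (f i))"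
      by (rule sums_unique[symmetric])
  qed
  show "cinner (f + g) h = cinner f h + cinner g h"
    by transfer (simp add: cinner_add_left suminf_add summable_sq_cinner)
  show "cinner (a *\<^sub>C f) g = a * cinner f g"
    by transfer (simp add: cinner_scaleC_left suminf_mult summable_sq_cinner)
  show "Re (cinner f g) = inner f g"
    by transfer (simp add: Re_suminf summable_sq_cinner Re_cinner)
qed

end

lemma norm_ell2_sq: "(norm f)\<^sup>2 = (\<Sum>i. (norm (component f i))\<^sup>2)"
  by (simp add: power2_norm_eq_inner inner_ell2.rep_eq)

lemma summable_component: "summable (\<lambda>i. (norm (component f i))\<^sup>2)"
  using component[of f] by simp

lemma sum_component_le: "(\<Sum>i<n. (norm (component f i))\<^sup>2) \<le> (norm f)\<^sup>2"
  unfolding norm_ell2_sq by (intro sum_le_suminf summable_component) auto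

lemma norm_component_le: "norm (component f i) \<le> norm f"
proof -
  have "(norm (component f i))\<^sup>2 \<le> (\<Sum>j<Suc i. (norm (component f j))\<^sup>2)"
    by (simp add: sum_nonneg)
  also have "\<dots> \<le> (norm f)\<^sup>2" by (rule sum_component_le)
  finally show ?thesis by (simp add: power2_le_iff_abs_le)
qed

instance ell2 :: (chilbert_space) chilbert_space
proof
  fix X :: "nat \<Rightarrow> 'a ell2"
  assume X: "Cauchy X"
  have "Cauchy (\<lambda>n. component (X n) i)" for i
    unfolding Cauchy_iff
  proof (intro allI impI)
    fix e :: real assume "e > 0"
    with X obtain M where M: "\<And>m n. m \<ge> M \<Longrightarrow> n \<ge> M \<Longrightarrow> norm (X m - X n) < e"
      by (meson Cauchy_iff)
    have "norm (component (X m) i - component (X n) i) < e" if "m \<ge> M" "n \<ge> M" for m n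
      using norm_component_le[of "X m - X n" i] M[OF that] by (simp add: minus_ell2.rep_eq)
    then show "\<exists>M. \<forall>m\<ge>M. \<forall>n\<ge>M. norm (component (X m) i - component (X n) i) < e" by blast
  qed
  then have "\<forall>i. \<exists>l. (\<lambda>n. component (X n) i) \<longlonglongrightarrow> l"
    by (simp add: Cauchy_convergent_iff convergent_def)
  then obtain l where l: "\<And>i. (\<lambda>n. component (X n) i) \<longlonglongrightarrow> l i" by metis
  have tail: "\<exists>M. \<forall>n\<ge>M. \<forall>k. (\<Sum>i<k. (norm (component (X n) i - l i))\<^sup>2) \<le> e\<^sup>2" if "e > 0" for e :: real
  proof -
    from X that obtain M where M: "\<And>m n. m \<ge> M \<Longrightarrow> n \<ge> M \<Longrightarrow> norm (X m - X n) < e"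
      by (meson Cauchy_iff)
    have "(\<Sum>i<k. (norm (component (X n) i - l i))\<^sup>2) \<le> e\<^sup>2" if n: "n \<ge> M" for n k
    proof (rule LIMSEQ_le_const2)
      show "(\<lambda>m. \<Sum>i<k. (norm (component (X n) i - component (X m) i))\<^sup>2)
              \<longlonglongrightarrow> (\<Sum>i<k. (norm (component (X n) i - l i))\<^sup>2)"
        by (intro tendsto_intros l)
      have "(\<Sum>i<k. (norm (component (X n) i - component (X m) i))\<^sup>2) \<le> e\<^sup>2" if "m \<ge> M" for m
      proof -
        have "(\<Sum>i<k. (norm (component (X n) i - component (X m) i))\<^sup>2) \<le> (norm (X n - X m))\<^sup>2"
          using sum_component_le[of "X n - X m" k] by (simp add: minus_ell2.rep_eq)
        also have "\<dots> \<le> e\<^sup>2"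
          using M[OF n that] by (intro power_mono) auto
        finally show ?thesis .
      qed
      then show "\<exists>N. \<forall>m\<ge>N. (\<Sum>i<k. (norm (component (X n) i - component (X m) i))\<^sup>2) \<le> e\<^sup>2"
        by blast
    qed
    then show ?thesis by blast
  qed
  have summ: "summable (\<lambda>i. (norm (component (X n) i - l i))\<^sup>2)"
    if "\<forall>k. (\<Sum>i<k. (norm (component (X n) i - l i))\<^sup>2) \<le> e" for n and e :: real
    using that by (intro bounded_imp_summable[of _ e])
      (auto simp: lessThan_Suc_atMost[symmetric] simp del: sum.lessThan_Suc)
  obtain M where "\<forall>n\<ge>M. \<forall>k. (\<Sum>i<k. (norm (component (X n) i - l i))\<^sup>2) \<le> 1\<^sup>2"
    using tail[of 1] by auto
  then have "summable (\<lambda>i. (norm (component (X M) i - l i))\<^sup>2)"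
    by (intro summ[of M "1\<^sup>2"]) auto
  then have "summable (\<lambda>i. (norm (component (X M) i + - (component (X M) i - l i)))\<^sup>2)"
    by (intro summable_sq_add summable_component) (simp add: norm_minus_commute)
  then have "summable (\<lambda>i. (norm (l i))\<^sup>2)" by simp
  then have L: "component (Abs_ell2 l) = l" by (simp add: Abs_ell2_inverse)
  have "X \<longlonglongrightarrow> Abs_ell2 l"
  proof (rule metric_LIMSEQ_I)
    fix r :: real assume r: "r > 0"
    then obtain N where N: "\<forall>n\<ge>N. \<forall>k. (\<Sum>i<k. (norm (component (X n) i - l i))\<^sup>2) \<le> (r/2)\<^sup>2"
      using tail[of "r/2"] by auto
    have "dist (X n) (Abs_ell2 l) < r" if "n \<ge> N" for n
    proof -
      have "(norm (X n - Abs_ell2 l))\<^sup>2 = (\<Sum>i. (norm (component (X n) i - l i))\<^sup>2)"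
        by (simp add: norm_ell2_sq minus_ell2.rep_eq L)
      also have "\<dots> \<le> (r/2)\<^sup>2"
        using N that by (intro suminf_le_const summ[of n "(r/2)\<^sup>2"]) auto
      finally have "norm (X n - Abs_ell2 l) \<le> r/2"
        using r power2_le_imp_le[of _ "r/2"] by simp
      then show ?thesis using r by (simp add: dist_norm)
    qed
    then show "\<exists>N. \<forall>n\<ge>N. dist (X n) (Abs_ell2 l) < r" by blast
  qed
  then show "convergent X" by (auto simp: convergent_def)
qed

section \<open>Unilateral weighted shifts\<close>

text \<open>The weights are indexed from 1; the value \<open>S 0\<close> is irrelevant.\<close>

definition bounded_weights :: "(nat \<Rightarrow> 'a::complex_inner \<Rightarrow> 'a) \<Rightarrow> bool" where
  "bounded_weights S \<longleftrightarrow> (\<forall>j\<ge>1. bounded_clinear (S j)) \<and> bdd_above ((\<lambda>j. onorm (S j)) ` {1..})"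

definition weighted_shift :: "(nat \<Rightarrow> 'a::complex_inner \<Rightarrow> 'a) \<Rightarrow> 'a ell2 \<Rightarrow> 'a ell2" where
  "weighted_shift S h = Abs_ell2 (\<lambda>i. case i of 0 \<Rightarrow> 0 | Suc n \<Rightarrow> S (Suc n) (component h n))"

lemma component_weighted_shift:
  assumes "bounded_weights S"
  shows "component (weighted_shift S h) i = (case i of 0 \<Rightarrow> 0 | Suc n \<Rightarrow> S (Suc n) (component h n))"
proof -
  let ?g = "\<lambda>i. case i of 0 \<Rightarrow> 0 | Suc n \<Rightarrow> S (Suc n) (component h n)"
  obtain M where M: "\<And>j. j \<ge> 1 \<Longrightarrow> onorm (S j) \<le> M"
    using assms by (auto simp: bounded_weights_def bdd_above_def)
  have "norm (S (Suc n) x) \<le> M * norm x" for n x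
  proof -
    have "bounded_linear (S (Suc n))"
      using assms by (simp add: bounded_weights_def bounded_clinear_def)
    then have "norm (S (Suc n) x) \<le> onorm (S (Suc n)) * norm x" by (rule onorm)
    also have "\<dots> \<le> M * norm x" using M[of "Suc n"] by (intro mult_right_mono) auto
    finally show ?thesis .
  qed
  then have "(norm (S (Suc n) x))\<^sup>2 \<le> M\<^sup>2 * (norm x)\<^sup>2" for n x
    by (metis norm_ge_zero power_mono power_mult_distrib)
  then have "summable (\<lambda>n. (norm (S (Suc n) (component h n)))\<^sup>2)"
    by (intro summable_comparison_test'[OF summable_mult[OF summable_component[of h], of "M\<^sup>2"]]) auto
  then have "summable (\<lambda>i. (norm (?g i))\<^sup>2)"
    by (subst summable_Suc_iff[symmetric]) simp
  then show ?thesis by (simp add: weighted_shift_def Abs_ell2_inverse)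
qed

end

theory Submission
  imports Defs
begin

text \<open>
  With \<open>P\<^sub>n = S\<^sub>n \<cdots> S\<^sub>1\<close> invertible, the shift is \<open>(m + 2)\<close>-isometric as soon as every
  \<open>n \<mapsto> \<langle>P\<^sub>n x, P\<^sub>n y\<rangle>\<close> is a polynomial of degree at most \<open>m + 1\<close>. The prescribed weights fix this
  polynomial at \<open>0, \<dots>, m\<close>, which leaves the leading coefficient free: it is taken to be a large
  multiple of the inner product, so that the forms stay coercive for \<open>n > m\<close>. They then determine
  the later weights recursively, as the positive square roots of
  \<open>P\<^sub>n\<^sup>-\<^sup>* Q\<^sub>n\<^sub>+\<^sub>1 P\<^sub>n\<^sup>-\<^sup>1\<close>, where \<open>Q\<^sub>n\<close> represents the \<open>n\<close>-th form; consecutive forms being comparable,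
  the weights are uniformly bounded.
\<close>

section \<open>Riesz representation and adjoints\<close>

text \<open>The functional \<open>J\<close> defined below has a minimiser \<open>z\<close>, and the
  vanishing of its first variation there is the claimed identity. Completeness enters through the
  convergence of a minimising sequence.\<close>

lemma riesz_representation:
  fixes \<phi> :: "'a::{real_inner, complete_space} \<Rightarrow> real"
  assumes "bounded_linear \<phi>"
  obtains z where "\<And>x. \<phi> x = inner z x"
proof -
  interpret \<phi>: bounded_linear \<phi> by fact
  define J where "J x = inner x x - 2 * \<phi> x" for x
  obtain K where K: "\<And>x. norm (\<phi> x) \<le> norm x * K" using \<phi>.bounded by blast
  have J_ge: "J x \<ge> - K\<^sup>2" for x
    using K[of x] zero_le_power2[of "norm x - K"]
    by (simp add: J_def power2_eq_square algebra_simps flip: power2_norm_eq_inner)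
  define d where "d = Inf (range J)"
  have bdd: "bdd_below (range J)" using J_ge by (intro bdd_belowI[of _ "-K\<^sup>2"]) auto
  have d_le: "d \<le> J x" for x unfolding d_def by (rule cInf_lower[OF _ bdd]) auto
  have "\<exists>x. J x < d + 1 / real (Suc n)" for n
    using cInf_lessD[of "range J" "d + 1 / real (Suc n)"] by (auto simp: d_def)
  then obtain X where X: "\<And>n. J (X n) < d + 1 / real (Suc n)" by metis
  \<comment> \<open>Parallelogram law with midpoint \<open>w\<close>: the linear terms cancel, and
    \<open>d \<le> J w\<close> then shows that a minimising sequence is Cauchy.\<close>
  have par: "(norm (x - y))\<^sup>2 \<le> 2 * (J x - d) + 2 * (J y - d)" for x y
  proof -
    define w where "w = (1/2) *\<^sub>R (x + y)"
    have "(norm (x - y))\<^sup>2 = 2 * J x + 2 * J y - 4 * J w"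
      by (simp add: w_def J_def \<phi>.scaleR \<phi>.add power2_norm_eq_inner inner_commute algebra_simps)
    then show ?thesis using d_le[of w] by simp
  qed
  have "Cauchy X"
  proof (rule metric_CauchyI)
    fix e :: real assume e: "e > 0"
    obtain M :: nat where M: "4 / e\<^sup>2 < M" using reals_Archimedean2 by blast
    have "dist (X i) (X j) < e" if "i \<ge> M" "j \<ge> M" for i j
    proof -
      have small: "1 / real (Suc n) \<le> e\<^sup>2 / 4" if "n \<ge> M" for n
      proof -
        have "4 / e\<^sup>2 < real (Suc n)" using M that by linarith
        then show ?thesis using e by (simp add: field_simps)
      qed
      have "(norm (X i - X j))\<^sup>2 < e\<^sup>2"
        using par[of "X i" "X j"] X[of i] X[of j] small[OF that(1)] small[OF that(2)]
        unfolding right_diff_distrib by linarith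
      then show ?thesis using e by (simp add: dist_norm power2_less_imp_less)
    qed
    then show "\<exists>M. \<forall>i\<ge>M. \<forall>j\<ge>M. dist (X i) (X j) < e" by blast
  qed
  then obtain z where z: "X \<longlonglongrightarrow> z" by (auto simp: Cauchy_convergent_iff convergent_def)
  have "(\<lambda>n. J (X n)) \<longlonglongrightarrow> J z"
    unfolding J_def by (intro tendsto_intros z \<phi>.tendsto)
  moreover have "(\<lambda>n. d + 1 / real (Suc n)) \<longlonglongrightarrow> d + 0"
    by (intro tendsto_intros LIMSEQ_Suc lim_1_over_n)
  ultimately have Jz: "J z \<le> d"
    using X by (intro LIMSEQ_le[of "\<lambda>n. J (X n)" _ "\<lambda>n. d + 1 / real (Suc n)"]) (auto intro: less_imp_le)
  have "\<phi> x = inner z x" for x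
  proof (rule ccontr)
    assume ne: "\<phi> x \<noteq> inner z x"
    define e where "e = inner z x - \<phi> x"
    define N where "N = inner x x + 1"
    have N: "N > 0" by (simp add: N_def add_nonneg_pos)
    \<comment> \<open>This \<open>t\<close> minimises \<open>N * t\<^sup>2 + 2 * t * e\<close>. The
      summand 1 in \<open>N\<close> makes the division safe for every \<open>x\<close>.\<close>
    define t where "t = - (e / N)"
    have "J (z + t *\<^sub>R x) = J z + t\<^sup>2 * (N - 1) + 2 * t * e"
      by (simp add: J_def e_def N_def \<phi>.scaleR \<phi>.add inner_commute algebra_simps power2_eq_square)
    also have "\<dots> = J z - (e / N)\<^sup>2 * (N + 1)"
      using N by (simp add: t_def power2_eq_square field_simps)
    also have "\<dots> < J z" using N ne by (simp add: e_def)
    finally show False using d_le[of "z + t *\<^sub>R x"] Jz by linarith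
  qed
  then show thesis by (rule that)
qed

section \<open>Complex scaling and bounded complex-linear operators\<close>

lemma inner_scaleC_left: "inner (a *\<^sub>C x) y = inner x (cnj a *\<^sub>C y)"
  for x y :: "'a::complex_inner"
proof -
  have "cinner (a *\<^sub>C x) y = cinner x (cnj a *\<^sub>C y)"
    by (metis cinner_commute cinner_scaleC_left complex_cnj_cnj complex_cnj_mult)
  then show ?thesis by (metis Re_cinner)
qed

lemma bounded_linear_scaleC: "bounded_linear ((*\<^sub>C) a)"
  for a :: complex
proof (rule bounded_linear_intro)
  fix x y :: "'a::complex_inner" and r
  show "a *\<^sub>C (x + y) = a *\<^sub>C x + a *\<^sub>C y" by (rule scaleC_add_right)
  show "a *\<^sub>C r *\<^sub>R x = r *\<^sub>R a *\<^sub>C x"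
    by (simp flip: scaleC_of_real add: scaleC_scaleC mult.commute)
  show "norm (a *\<^sub>C x) \<le> norm x * cmod a" by (simp add: norm_scaleC)
qed

lemmas linear_scaleC = bounded_linear.linear[OF bounded_linear_scaleC]

lemma bounded_clinearD:
  assumes "bounded_clinear T"
  shows "bounded_linear T" and "T (a *\<^sub>C x) = a *\<^sub>C T x"
  using assms by (auto simp: bounded_clinear_def)

lemma bounded_clinear_id: "bounded_clinear (\<lambda>x. x)"
  by (simp add: bounded_clinear_def bounded_linear_ident)

lemma bounded_clinear_compose:
  "bounded_clinear S \<Longrightarrow> bounded_clinear T \<Longrightarrow> bounded_clinear (\<lambda>x. S (T x))"
  by (simp add: bounded_clinear_def bounded_linear_compose)

lemma bounded_clinear_add:
  "bounded_clinear S \<Longrightarrow> bounded_clinear T \<Longrightarrow> bounded_clinear (\<lambda>x. S x + T x)"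
  by (simp add: bounded_clinear_def bounded_linear_add scaleC_add_right)

lemma bounded_clinear_scaleR:
  assumes "bounded_clinear T"
  shows "bounded_clinear (\<lambda>x. r *\<^sub>R T x)"
  using assms
  by (auto simp: bounded_clinear_def linear_scale[OF linear_scaleC]
      intro: bounded_linear_compose[OF bounded_linear_scaleR_right])

lemma bounded_clinear_sum:
  assumes "\<And>i. i \<in> I \<Longrightarrow> bounded_clinear (T i)"
  shows "bounded_clinear (\<lambda>x. \<Sum>i\<in>I. T i x)"
  using assms
  by (auto simp: bounded_clinear_def linear_sum[OF linear_scaleC]
      intro!: bounded_linear_sum)

text \<open>The real identity at \<open>f\<close> gives the real part, at
  \<open>\<i> *\<^sub>C f\<close> the imaginary part. Later arguments can therefore work with
  \<open>inner\<close> alone.\<close>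

lemma cinner_eq_of_inner_eq:
  fixes T R :: "'a::complex_inner \<Rightarrow> 'a"
  assumes "bounded_clinear T" and "\<And>f g. inner (T f) g = inner f (R g)"
  shows "cinner (T f) g = cinner f (R g)"
  using bounded_clinearD(2)[OF assms(1)] assms(2)[of f g] assms(2)[of "\<i> *\<^sub>C f" g]
  by (simp add: complex_eq_iff Re_cinner Im_cinner)

lemma inner_le_norm_mult:
  fixes a b :: "'a::real_inner"
  assumes "norm a \<le> k"
  shows "inner a b \<le> k * norm b"
  using norm_cauchy_schwarz[of a b] mult_right_mono[OF assms norm_ge_zero[of b]] by linarith

text \<open>\<open>cadjoint\<close> is a definite description, so existence and uniqueness are both
  required. Riesz yields \<open>R g\<close> for each \<open>g\<close>; linearity is then forced,
  since a vector is determined by its inner products (\<open>R_eq\<close>).\<close>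

lemma cadjoint_ex1:
  fixes T :: "'a::chilbert_space \<Rightarrow> 'a"
  assumes T: "bounded_clinear T"
  shows "\<exists>!R. bounded_clinear R \<and> (\<forall>f g. cinner (T f) g = cinner f (R g))"
proof -
  interpret T: bounded_linear T using T by (rule bounded_clinearD)
  have "\<exists>z. \<forall>f. inner (T f) g = inner f z" for g
  proof -
    have *: "bounded_linear (\<lambda>f. inner (T f) g)"
      by (intro bounded_linear_compose[OF bounded_linear_inner_left] T.bounded_linear_axioms)
    obtain z where "\<And>f. inner (T f) g = inner z f" using riesz_representation[OF *] by auto
    then show ?thesis by (metis inner_commute)
  qed
  then obtain R where R: "\<And>f g. inner (T f) g = inner f (R g)" by metis
  have R_eq: "R g = h" if "\<And>f. inner (T f) g = inner f h" for g h
    using that vector_eq_ldot[of "R g" h] by (simp add: R)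
  have "bounded_clinear R"
    unfolding bounded_clinear_def
  proof (intro conjI allI bounded_linear_intro)
    fix x y r a
    show "R (x + y) = R x + R y" by (rule R_eq) (simp add: inner_add_right R)
    show "R (r *\<^sub>R x) = r *\<^sub>R R x" by (rule R_eq) (simp add: R)
    show "R (a *\<^sub>C x) = a *\<^sub>C R x"
    proof (rule R_eq)
      fix f
      have "inner (T f) (a *\<^sub>C x) = inner (T (cnj a *\<^sub>C f)) x"
        by (simp add: inner_scaleC_left bounded_clinearD(2)[OF T])
      also have "\<dots> = inner f (a *\<^sub>C R x)" by (simp add: R inner_scaleC_left)
      finally show "inner (T f) (a *\<^sub>C x) = inner f (a *\<^sub>C R x)" .
    qed
    \<comment> \<open>Testing the adjoint identity at \<open>R x\<close> itself bounds the square of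
      its norm; one factor is then cancelled.\<close>
    have "norm (R x) * norm (R x) = inner (T (R x)) x"
      by (simp add: R flip: power2_norm_eq_inner power2_eq_square)
    also have "\<dots> \<le> onorm T * norm (R x) * norm x"
      by (intro inner_le_norm_mult onorm T.bounded_linear_axioms)
    finally have "norm (R x) * norm (R x) \<le> norm (R x) * (norm x * onorm T)" by (simp add: ac_simps)
    then show "norm (R x) \<le> norm x * onorm T"
      using onorm_pos_le[OF T.bounded_linear_axioms]
      by (cases "norm (R x) = 0") (auto simp: mult_le_cancel_left)
  qed
  moreover have "R' = R" if "\<forall>f g. cinner (T f) g = cinner f (R' g)" for R'
  proof
    fix g
    have "inner (T f) g = inner f (R' g)" for f using that by (metis Re_cinner)
    then show "R' g = R g" using R_eq[of g "R' g"] by simp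
  qed
  ultimately show ?thesis
    by (intro ex1I[of _ R] conjI allI cinner_eq_of_inner_eq[OF T R]) auto
qed

lemma
  fixes T :: "'a::chilbert_space \<Rightarrow> 'a"
  assumes "bounded_clinear T"
  shows bounded_clinear_cadjoint: "bounded_clinear (cadjoint T)"
    and inner_cadjoint_left: "inner (cadjoint T g) f = inner g (T f)"
proof -
  have *: "bounded_clinear (cadjoint T) \<and> (\<forall>f g. cinner (T f) g = cinner f (cadjoint T g))"
    unfolding cadjoint_def by (rule theI'[OF cadjoint_ex1[OF assms]])
  then show "bounded_clinear (cadjoint T)" by blast
  have "inner f (cadjoint T g) = inner (T f) g" for f g using * by (metis Re_cinner)
  then show "inner (cadjoint T g) f = inner g (T f)" by (metis inner_commute)
qed

lemma inner_cadjoint_funpow: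
  fixes T :: "'a::chilbert_space \<Rightarrow> 'a"
  assumes "bounded_clinear T"
  shows "inner ((cadjoint T ^^ k) f) g = inner f ((T ^^ k) g)"
  by (induction k arbitrary: g)
    (simp_all add: inner_cadjoint_left[OF assms] funpow_swap1[of T])

section \<open>Positive square roots\<close>

text \<open>The lower bound serves twice: it gives injectivity, and it bounds the inverse by
  \<open>1 / \<delta>\<close>.\<close>

lemma invertible_opI:
  fixes T :: "'a::complex_inner \<Rightarrow> 'a"
  assumes T: "bounded_clinear T" and "surj T" and "\<delta> > 0"
    and lower: "\<And>x. \<delta> * norm x \<le> norm (T x)"
  shows "invertible_op T"
proof -
  interpret T: bounded_linear T using T by (rule bounded_clinearD)
  have "inj T"
  proof (rule injI)
    fix x y assume "T x = T y"
    then show "x = y" using lower[of "x - y"] \<open>\<delta> > 0\<close> by (simp add: T.diff mult_le_0_iff)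
  qed
  then have R: "T (inv T x) = x" "inv T (T x) = x" for x
    using \<open>surj T\<close> by (simp_all add: surj_f_inv_f)
  have "bounded_clinear (inv T)"
    unfolding bounded_clinear_def
  proof (intro conjI allI bounded_linear_intro)
    fix x y r a
    show "inv T (x + y) = inv T x + inv T y"
      by (metis R T.add)
    show "inv T (r *\<^sub>R x) = r *\<^sub>R inv T x"
      by (metis R T.scaleR)
    show "inv T (a *\<^sub>C x) = a *\<^sub>C inv T x"
      by (metis R T bounded_clinearD(2))
    show "norm (inv T x) \<le> norm x * (1 / \<delta>)"
      using lower[of "inv T x"] \<open>\<delta> > 0\<close> by (simp add: R field_simps)
  qed
  then show ?thesis unfolding invertible_op_def using T R by (auto simp: fun_eq_iff)
qed

text \<open>The order on \<open>complex\<close> also demands a zero imaginary part, which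
  self-adjointness supplies.\<close>

lemma positive_opI:
  fixes T :: "'a::complex_inner \<Rightarrow> 'a"
  assumes T: "bounded_clinear T" and selfadj: "\<And>x y. inner (T x) y = inner x (T y)"
    and pos: "\<And>x. x \<noteq> 0 \<Longrightarrow> inner (T x) x > 0"
  shows "positive_op T"
proof -
  have "cinner (T f) f = cnj (cinner (T f) f)" for f
    using cinner_eq_of_inner_eq[OF T selfadj, of f f] cinner_commute[of "T f" f] by simp
  then have "Im (cinner (T f) f) = 0" for f
    by (metis Reals_cnj_iff complex_is_Real_iff)
  then show ?thesis using T pos by (simp add: positive_op_def less_complex_def Re_cinner)
qed

text \<open>Cauchy-Schwarz for the semidefinite form \<open>inner (A x) y\<close>, in the additive
  version \<open>cs\<close>, turns a bound on the quadratic form into a bound on the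
  operator.\<close>

lemma selfadjoint_norm_le:
  fixes A :: "'a::real_inner \<Rightarrow> 'a"
  assumes "linear A" and selfadj: "\<And>x y. inner (A x) y = inner x (A y)"
    and pos: "\<And>x. inner (A x) x \<ge> 0" and le: "\<And>x. inner (A x) x \<le> q * (norm x)\<^sup>2"
  shows "norm (A x) \<le> q * norm x"
proof -
  interpret A: linear A by fact
  have q: "q * (norm x)\<^sup>2 \<ge> 0" for x :: 'a using pos[of x] le[of x] by linarith
  have cs: "2 * inner (A x) y \<le> inner (A x) x + inner (A y) y" for x y
    using pos[of "x - y"] selfadj[of y x]
    by (simp add: A.diff inner_diff_left inner_diff_right inner_commute)
  show ?thesis
  proof (cases "A x = 0 \<or> x = 0")
    case True
    have "0 \<le> q * norm x"
      using q[of x] by (cases "x = 0") (auto simp: zero_le_mult_iff)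
    with True show ?thesis using A.zero by auto
  next
    case False
    \<comment> \<open>With this scaling \<open>t *\<^sub>R A x\<close> has the norm of
      \<open>x\<close>, so both terms on the right of \<open>cs\<close> get the same bound.\<close>
    define t where "t = norm x / norm (A x)"
    have n: "norm x > 0" "norm (A x) > 0" using False by auto
    have "2 * (t * (norm (A x))\<^sup>2) \<le> q * (norm x)\<^sup>2 + q * (norm (t *\<^sub>R A x))\<^sup>2"
      using cs[of x "t *\<^sub>R A x"] le[of x] le[of "t *\<^sub>R A x"] by (simp add: power2_norm_eq_inner)
    also have "norm (t *\<^sub>R A x) = norm x" using n by (simp add: t_def)
    also have "t * (norm (A x))\<^sup>2 = norm x * norm (A x)" using n by (simp add: t_def power2_eq_square)
    finally have "norm x * norm (A x) \<le> norm x * (q * norm x)" by (simp add: power2_eq_square ac_simps)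
    then show ?thesis using n by simp
  qed
qed

text \<open>Writing the square root as \<open>I - Y\<close> turns \<open>(I - Y)\<^sup>2 = I - A\<close> into the fixed point
  equation \<open>Y = (A + Y\<^sup>2) / 2\<close>, a contraction on the ball whose radius is the smaller root of
  \<open>r\<^sup>2 - 2 r + q = 0\<close>.\<close>

lemma sqrt_near_identity:
  fixes A :: "'a::chilbert_space \<Rightarrow> 'a"
  assumes A: "bounded_clinear A" and A_sa: "\<And>x y. inner (A x) y = inner x (A y)"
    and A_le: "\<And>x. norm (A x) \<le> q * norm x" and q: "0 \<le> q" "q < 1"
  obtains Y :: "'a \<Rightarrow> 'a" and r where "bounded_clinear Y" "\<And>x y. inner (Y x) y = inner x (Y y)"
    "(0::real) \<le> r" "r < 1" "\<And>x. norm (Y x) \<le> r * norm x" "\<And>x. 2 *\<^sub>R Y x = A x + Y (Y x)"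
proof -
  define r where "r = 1 - sqrt (1 - q)"
  have r: "0 \<le> r" "r < 1" using q by (auto simp: r_def)
  have r_eq: "q + r * r = 2 * r" using q by (simp add: r_def algebra_simps)
  define AL where "AL = Blinfun A"
  have AL: "blinfun_apply AL = A"
    unfolding AL_def using A by (simp add: bounded_clinear_def bounded_linear_Blinfun_apply)
  have AL_norm: "norm AL \<le> q"
    using A_le q by (intro norm_blinfun_bound) (auto simp: AL)
  \<comment> \<open>Self-adjointness and complex linearity are closed conditions; building them into
    \<open>s\<close> passes them on to the fixed point.\<close>
  define s :: "('a \<Rightarrow>\<^sub>L 'a) set" where
    "s = {Y. norm Y \<le> r \<and> (\<forall>x y. inner (blinfun_apply Y x) y = inner x (blinfun_apply Y y)) \<and>
      (\<forall>a x. blinfun_apply Y (a *\<^sub>C x) = a *\<^sub>C blinfun_apply Y x)}"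
  define F where "F Y = (1/2) *\<^sub>R (AL + (Y o\<^sub>L Y))" for Y :: "'a \<Rightarrow>\<^sub>L 'a"
  have "closed s"
    unfolding s_def
    by (intro closed_Collect_conj closed_Collect_all closed_Collect_le closed_Collect_eq
        continuous_intros bounded_linear.continuous_on[OF bounded_linear_scaleC])
  then have "complete s" by (simp add: complete_eq_closed)
  moreover have "0 \<in> s" using r by (simp add: s_def linear_0[OF linear_scaleC])
  then have "s \<noteq> {}" by blast
  moreover have "F ` s \<subseteq> s"
  proof
    fix Z assume "Z \<in> F ` s"
    then obtain Y where Y: "Y \<in> s" and Z: "Z = F Y" by blast
    have "norm (Y o\<^sub>L Y) \<le> r * r"
      using Y r by (intro order_trans[OF norm_blinfun_compose mult_mono]) (auto simp: s_def)
    then have "norm (AL + (Y o\<^sub>L Y)) \<le> 2 * r"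
      using AL_norm norm_triangle_ineq[of AL "Y o\<^sub>L Y"] r_eq by linarith
    moreover have "Z (a *\<^sub>C x) = a *\<^sub>C Z x" for a x
      using Y bounded_clinearD(2)[OF A]
      by (simp add: s_def linear_scale[OF linear_scaleC] Z F_def blinfun.bilinear_simps AL scaleC_add_right)
    ultimately show "Z \<in> s" using Y
      by (simp add: s_def Z F_def blinfun.bilinear_simps AL A_sa inner_add_left inner_add_right)
  qed
  moreover have "\<forall>X\<in>s. \<forall>Y\<in>s. dist (F X) (F Y) \<le> r * dist X Y"
  proof (intro ballI)
    fix X Y assume X: "X \<in> s" and Y: "Y \<in> s"
    \<comment> \<open>A splitting of the difference of squares that is valid without commutativity.
      Each piece has norm at most \<open>r * norm (X - Y)\<close>, and the factor 1/2 averages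
      them.\<close>
    have "F X - F Y = (1/2) *\<^sub>R ((X o\<^sub>L (X - Y)) + ((X - Y) o\<^sub>L Y))"
      by (rule blinfun_eqI) (simp add: F_def blinfun.bilinear_simps algebra_simps)
    moreover have "norm (X o\<^sub>L (X - Y)) \<le> r * norm (X - Y)"
      using X by (intro order_trans[OF norm_blinfun_compose] mult_right_mono) (auto simp: s_def)
    moreover have "norm ((X - Y) o\<^sub>L Y) \<le> norm (X - Y) * r"
      using Y by (intro order_trans[OF norm_blinfun_compose] mult_left_mono) (auto simp: s_def)
    ultimately show "dist (F X) (F Y) \<le> r * dist X Y"
      using norm_triangle_ineq[of "X o\<^sub>L (X - Y)" "(X - Y) o\<^sub>L Y"]
      by (simp add: dist_norm mult.commute[of _ r])
  qed
  ultimately obtain Y where Y: "Y \<in> s" "F Y = Y"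
    using Banach_fix[of s r F] r by blast
  have "2 *\<^sub>R Y x = A x + Y (Y x)" for x
    using arg_cong[OF Y(2), of "\<lambda>Y. 2 *\<^sub>R blinfun_apply Y x"]
    by (simp add: F_def blinfun.bilinear_simps AL)
  moreover have "norm (Y x) \<le> r * norm x" for x
    using Y by (intro order_trans[OF norm_blinfun mult_right_mono]) (auto simp: s_def)
  moreover have "bounded_clinear Y" using Y by (simp add: s_def bounded_clinear_def blinfun.bounded_linear_right)
  ultimately show thesis using that[of "blinfun_apply Y" r] r Y by (simp add: s_def)
qed

text \<open>For \<open>M\<close> above the norm of \<open>B\<close>, the operator
  \<open>A = I - B / M\<close> lies between 0 and \<open>1 - \<epsilon> / M\<close>. The preceding
  lemma then gives \<open>(I - Y)\<^sup>2 = B / M\<close>, and \<open>S\<close> is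
  \<open>sqrt M\<close> times \<open>I - Y\<close>.\<close>

lemma positive_sqrt_exists:
  fixes B :: "'a::chilbert_space \<Rightarrow> 'a"
  assumes B: "bounded_clinear B" and B_sa: "\<And>x y. inner (B x) y = inner x (B y)"
    and "\<epsilon> > 0" and coercive: "\<And>x. \<epsilon> * (norm x)\<^sup>2 \<le> inner (B x) x"
  obtains S where "positive_op S" "invertible_op S" "\<And>x y. inner (S x) (S y) = inner (B x) y"
proof -
  interpret B: bounded_linear B using B by (rule bounded_clinearD)
  define M where "M = onorm B + \<epsilon>"
  have M: "M > 0" "\<epsilon> \<le> M"
    using \<open>\<epsilon> > 0\<close> onorm_pos_le[OF B.bounded_linear_axioms] by (auto simp: M_def)
  define A where "A x = x + (- 1 / M) *\<^sub>R B x" for x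
  have A: "bounded_clinear A"
    unfolding A_def by (intro bounded_clinear_add bounded_clinear_id bounded_clinear_scaleR B)
  have A_sa: "inner (A x) y = inner x (A y)" for x y
    by (simp add: A_def inner_diff_left inner_diff_right B_sa)
  have Axx: "inner (A x) x = (norm x)\<^sup>2 - inner (B x) x / M" for x
    by (simp add: A_def inner_diff_left power2_norm_eq_inner)
  have "inner (B x) x \<le> M * (norm x)\<^sup>2" for x
  proof -
    have "inner (B x) x \<le> onorm B * norm x * norm x"
      by (intro inner_le_norm_mult onorm B.bounded_linear_axioms)
    also have "\<dots> \<le> M * norm x * norm x"
      using \<open>\<epsilon> > 0\<close> by (intro mult_right_mono) (auto simp: M_def)
    finally show ?thesis by (simp add: power2_eq_square)
  qed
  then have A_pos: "inner (A x) x \<ge> 0" for x using M by (simp add: Axx field_simps)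
  have A_le: "inner (A x) x \<le> (1 - \<epsilon> / M) * (norm x)\<^sup>2" for x
    using M coercive[of x] by (simp add: Axx field_simps)
  obtain Y r where Y: "bounded_clinear Y" "\<And>x y. inner (Y x) y = inner x (Y y)"
      and r: "0 \<le> r" "r < 1" and Y_le: "\<And>x. norm (Y x) \<le> r * norm x"
      and Y_eq: "\<And>x. 2 *\<^sub>R Y x = A x + Y (Y x)"
    using sqrt_near_identity[OF A A_sa selfadjoint_norm_le[OF _ A_sa A_pos A_le]] M \<open>\<epsilon> > 0\<close>
      bounded_linear.linear[OF bounded_clinearD(1)[OF A]] by auto
  interpret Y: bounded_linear Y using Y(1) by (rule bounded_clinearD)
  define S where "S x = sqrt M *\<^sub>R (x + (-1) *\<^sub>R Y x)" for x
  have S: "bounded_clinear S"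
    unfolding S_def by (intro bounded_clinear_add bounded_clinear_id bounded_clinear_scaleR Y)
  have S_sa: "inner (S x) y = inner x (S y)" for x y
    by (simp add: S_def inner_diff_left inner_diff_right Y)
  have S_coercive: "sqrt M * (1 - r) * (norm x)\<^sup>2 \<le> inner (S x) x" for x
  proof -
    have "inner (Y x) x \<le> r * norm x * norm x"
      by (intro inner_le_norm_mult Y_le)
    then have "(1 - r) * (norm x)\<^sup>2 \<le> inner (x - Y x) x"
      by (simp add: inner_diff_left power2_norm_eq_inner[symmetric] power2_eq_square algebra_simps)
    then show ?thesis using M by (simp add: S_def mult.assoc)
  qed
  have S_S: "S (S x) = B x" for x
  proof -
    have "S (S x) = M *\<^sub>R (x - 2 *\<^sub>R Y x + Y (Y x))"
      using M by (simp add: S_def Y.scaleR Y.diff algebra_simps scaleR_2)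
    also have "\<dots> = M *\<^sub>R (x - A x)" by (simp add: Y_eq)
    finally show ?thesis using M by (simp add: A_def)
  qed
  define \<delta> where "\<delta> = sqrt M * (1 - r)"
  have \<delta>: "\<delta> > 0" using M r by (simp add: \<delta>_def)
  \<comment> \<open>\<open>S x = z\<close> is the fixed point equation
    \<open>x = z / sqrt M + Y x\<close>, and \<open>Y\<close> is a contraction.\<close>
  have "surj S"
  proof (rule surjI)
    fix z
    have "\<exists>!x. x \<in> UNIV \<and> (1 / sqrt M) *\<^sub>R z + Y x = x"
      using r Y_le by (intro Banach_fix[of UNIV r])
        (auto simp: complete_UNIV dist_norm simp flip: Y.diff)
    then obtain x where "x - Y x = (1 / sqrt M) *\<^sub>R z" by (metis add_diff_cancel_right')
    then have "S x = z" using M by (simp add: S_def)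
    then show "S (SOME x. S x = z) = z" by (rule someI)
  qed
  moreover have "\<delta> * norm x \<le> norm (S x)" for x
  proof (cases "x = 0")
    case False
    have "norm x * (\<delta> * norm x) \<le> norm x * norm (S x)"
      using S_coercive[of x] norm_cauchy_schwarz[of "S x" x]
      by (simp add: \<delta>_def power2_eq_square ac_simps)
    then show ?thesis using False by simp
  qed simp
  ultimately have "invertible_op S" using invertible_opI[OF S _ \<delta>] by blast
  moreover have "inner (S x) x > 0" if "x \<noteq> 0" for x
  proof -
    have "0 < \<delta> * (norm x)\<^sup>2" using \<delta> that by simp
    also have "\<dots> \<le> inner (S x) x" using S_coercive[of x] by (simp add: \<delta>_def)
    finally show ?thesis .
  qed
  then have "positive_op S" by (intro positive_opI S S_sa)
  moreover have "inner (S x) (S y) = inner (B x) y" for x y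
    by (metis S_S S_sa)
  ultimately show thesis using that by blast
qed

text \<open>The recursion step: \<open>T\<close> will be the product of the weights so far,
  \<open>Q\<close> the next form, and \<open>S\<close> the next weight. Conjugation by the inverse
  \<open>R\<close> keeps coercivity because \<open>norm x\<close> is at most a constant times
  \<open>norm (R x)\<close>.\<close>

lemma positive_factor_exists:
  fixes T Q :: "'a::chilbert_space \<Rightarrow> 'a"
  assumes T: "invertible_op T"
    and Q: "bounded_clinear Q" and Q_sa: "\<And>x y. inner (Q x) y = inner x (Q y)"
    and "\<epsilon> > 0" and coercive: "\<And>x. \<epsilon> * (norm x)\<^sup>2 \<le> inner (Q x) x"
  obtains S where "positive_op S" "invertible_op S"
    "\<And>x y. inner (S (T x)) (S (T y)) = inner (Q x) y"
proof -
  obtain R where R: "bounded_clinear R" "\<And>x. R (T x) = x" "\<And>x. T (R x) = x"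
    and T: "bounded_clinear T"
    using T by (auto simp: invertible_op_def fun_eq_iff)
  define B where "B x = cadjoint R (Q (R x))" for x
  have B: "bounded_clinear B"
    unfolding B_def by (intro bounded_clinear_compose[OF bounded_clinear_cadjoint]
      bounded_clinear_compose[OF Q] R)
  have B_inner: "inner (B x) y = inner (Q (R x)) (R y)" for x y
    by (simp add: B_def inner_cadjoint_left R)
  have B_sa: "inner (B x) y = inner x (B y)" for x y
    by (metis B_inner Q_sa inner_commute)
  define k where "k = onorm T + 1"
  have k: "k > 0" using onorm_pos_le[OF bounded_clinearD(1)[OF T]] by (simp add: k_def)
  have B_coercive: "\<epsilon> / k\<^sup>2 * (norm x)\<^sup>2 \<le> inner (B x) x" for x
  proof -
    have "norm x \<le> k * norm (R x)"
      using onorm[OF bounded_clinearD(1)[OF T], of "R x"] by (simp add: R k_def algebra_simps add_increasing)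
    then have "(norm x)\<^sup>2 \<le> k\<^sup>2 * (norm (R x))\<^sup>2"
      by (metis norm_ge_zero power_mono power_mult_distrib)
    then have "\<epsilon> / k\<^sup>2 * (norm x)\<^sup>2 \<le> \<epsilon> * (norm (R x))\<^sup>2"
      using k \<open>\<epsilon> > 0\<close> by (simp add: field_simps)
    also have "\<dots> \<le> inner (B x) x" by (simp add: B_inner coercive)
    finally show ?thesis .
  qed
  obtain S where "positive_op S" "invertible_op S" "\<And>x y. inner (S x) (S y) = inner (B x) y"
    using positive_sqrt_exists[OF B B_sa _ B_coercive] k \<open>\<epsilon> > 0\<close> by auto
  then show thesis using that by (simp add: B_inner R)
qed

section \<open>Forward differences\<close>

definition forward_diff :: "(nat \<Rightarrow> real) \<Rightarrow> nat \<Rightarrow> real" where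
  "forward_diff g n = g (Suc n) - g n"

text \<open>These are the coefficients in \<open>m_isometric\<close>, so that condition becomes the
  vanishing of an iterated difference. The induction is Pascal's rule.\<close>

lemma forward_diff_funpow:
  "(forward_diff ^^ M) g n = (\<Sum>k\<le>M. of_nat (M choose k) * (-1) ^ (M - k) * g (n + k))"
proof (induction M arbitrary: n)
  case (Suc M)
  let ?t = "\<lambda>M k. of_nat (M choose k) * (-1) ^ (M - k) :: real"
  have "(\<Sum>k\<le>Suc M. ?t (Suc M) k * g (n + k))
      = (-1) ^ Suc M * g n + (\<Sum>k\<le>M. (?t M k - of_nat (M choose Suc k) * (-1) ^ (Suc M - Suc k) * -1) * g (n + Suc k))"
    by (subst sum.atMost_Suc_shift) (simp add: algebra_simps)
  also have "\<dots> = (\<Sum>k\<le>M. ?t M k * g (Suc n + k)) - (\<Sum>k\<le>M. ?t M k * g (n + k))"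
  proof -
    have "(\<Sum>k\<le>M. ?t M k * g (n + k)) = (\<Sum>k\<le>Suc M. ?t M k * g (n + k))"
      by simp
    also have "\<dots> = (-1) ^ M * g n + (\<Sum>k\<le>M. of_nat (M choose Suc k) * (-1) ^ (M - Suc k) * g (n + Suc k))"
      by (subst sum.atMost_Suc_shift) simp
    also have "(\<Sum>k\<le>M. of_nat (M choose Suc k) * (-1) ^ (M - Suc k) * g (n + Suc k))
      = - (\<Sum>k\<le>M. of_nat (M choose Suc k) * (-1) ^ (M - k) * g (n + Suc k))"
    proof -
      \<comment> \<open>For \<open>k \<ge> M\<close> the subtraction \<open>M - Suc k\<close> is
        truncated, but there \<open>M choose Suc k\<close> is 0.\<close>
      have "of_nat (M choose Suc k) * (-1) ^ (M - Suc k) = - (of_nat (M choose Suc k) * (-1) ^ (M - k) :: real)" for k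
      proof (cases "k < M")
        case True
        then have "M - k = Suc (M - Suc k)" by simp
        then show ?thesis by simp
      qed simp
      then show ?thesis by (simp add: sum_negf)
    qed
    finally show ?thesis by (simp add: algebra_simps sum.distrib sum_subtractf)
  qed
  also have "\<dots> = (forward_diff ^^ Suc M) g n"
    by (simp add: forward_diff_def[of "(forward_diff ^^ M) g"] Suc)
  finally show ?case by (rule sym)
qed simp

text \<open>Binomial expansion of the \<open>n\<close>-th power of identity plus
  \<open>forward_diff\<close>. The induction hypothesis is applied both to \<open>g\<close> and to
  \<open>forward_diff g\<close>.\<close>

lemma newton_forward:
  "g (a + n) = (\<Sum>j\<le>n. of_nat (n choose j) * (forward_diff ^^ j) g a)"
proof (induction n arbitrary: g)
  case (Suc n)
  have "g (a + Suc n) = g (a + n) + forward_diff g (a + n)" by (simp add: forward_diff_def)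
  also have "\<dots> = (\<Sum>j\<le>Suc n. of_nat (n choose j) * (forward_diff ^^ j) g a)
      + (\<Sum>j\<le>n. of_nat (n choose j) * (forward_diff ^^ Suc j) g a)"
    unfolding Suc[of g] Suc[of "forward_diff g"] by (simp add: funpow_swap1)
  also have "(\<Sum>j\<le>Suc n. of_nat (n choose j) * (forward_diff ^^ j) g a)
      = g a + (\<Sum>j\<le>n. of_nat (n choose Suc j) * (forward_diff ^^ Suc j) g a)"
    by (subst sum.atMost_Suc_shift) simp
  also have "\<dots> + (\<Sum>j\<le>n. of_nat (n choose j) * (forward_diff ^^ Suc j) g a)
      = (\<Sum>j\<le>Suc n. of_nat (Suc n choose j) * (forward_diff ^^ j) g a)"
    unfolding sum.atMost_Suc_shift[of _ n] by (simp add: sum.distrib algebra_simps)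
  finally show ?case .
qed simp

text \<open>By Pascal's rule each difference lowers the bottom index by one: \<open>j\<close> of
  them leave the constant 1, one more gives 0.\<close>

lemma forward_diff_binomial_eq_0:
  assumes "j < k"
  shows "(forward_diff ^^ k) (\<lambda>n. of_nat (n choose j)) = (\<lambda>_. 0)"
proof -
  have zero: "(forward_diff ^^ k) (\<lambda>_. 0) = (\<lambda>_. 0)" for k
    by (induction k) (simp_all add: forward_diff_def fun_eq_iff)
  show ?thesis using assms
  proof (induction j arbitrary: k)
    case 0
    then obtain k' where "k = Suc k'" using not0_implies_Suc by auto
    moreover have "forward_diff (\<lambda>n. of_nat (n choose 0)) = (\<lambda>_. 0)"
      by (simp add: forward_diff_def fun_eq_iff)
    ultimately show ?case by (simp add: funpow_Suc_right zero del: funpow.simps)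
  next
    case (Suc j)
    then obtain k' where "k = Suc k'" "j < k'" using Suc_less_eq2 by auto
    moreover have "forward_diff (\<lambda>n. of_nat (n choose Suc j)) = (\<lambda>n. of_nat (n choose j))"
      by (simp add: forward_diff_def fun_eq_iff)
    ultimately show ?case using Suc.IH by (simp add: funpow_Suc_right del: funpow.simps)
  qed
qed

lemma forward_diff_funpow_sum:
  "(forward_diff ^^ k) (\<lambda>n. \<Sum>j\<in>I. c j * g j n) n = (\<Sum>j\<in>I. c j * (forward_diff ^^ k) (g j) n)"
  unfolding forward_diff_funpow sum_distrib_left
  by (subst sum.swap) (simp add: ac_simps)

lemma forward_diff_newton_eq_0:
  assumes "M < k"
  shows "(forward_diff ^^ k) (\<lambda>n. \<Sum>j\<le>M. c j * of_nat (n choose j)) n = 0"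
  using assms by (simp add: forward_diff_funpow_sum forward_diff_binomial_eq_0)

text \<open>The inserted factor is at least 1, and the product counts the \<open>j\<close>-subsets
  of \<open>M\<close>-subsets.\<close>

lemma binomial_le_mult_binomial:
  assumes "j \<le> M" "M \<le> n"
  shows "n choose j \<le> (M choose j) * (n choose M)"
proof -
  have "n choose j \<le> (n choose j) * ((n - j) choose (M - j))"
    using assms by (simp add: Suc_le_eq)
  also have "\<dots> = (M choose j) * (n choose M)"
    using assms choose_mult[of j M n] by (simp add: mult.commute)
  finally show ?thesis .
qed

text \<open>What matters is that the factor is independent of \<open>n\<close>: it makes the
  constants of the interpolation uniform.\<close>

lemma sum_binomial_le:
  "m < n \<Longrightarrow> (\<Sum>j\<le>m. n choose j) \<le> 2 ^ Suc m * (n choose Suc m)"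
proof -
  assume "m < n"
  then have "(\<Sum>j\<le>m. n choose j) \<le> (\<Sum>j\<le>m. (Suc m choose j) * (n choose Suc m))"
    by (intro sum_mono binomial_le_mult_binomial) auto
  also have "\<dots> \<le> (\<Sum>j\<le>Suc m. (Suc m choose j) * (n choose Suc m))" by simp
  also have "\<dots> = 2 ^ Suc m * (n choose Suc m)"
    unfolding sum_distrib_right[symmetric] choose_row_sum ..
  finally show ?thesis .
qed

section \<open>Weighted shifts\<close>

lemma bounded_clinear_weighted_shift:
  fixes S :: "nat \<Rightarrow> 'a::complex_inner \<Rightarrow> 'a"
  assumes S: "bounded_weights S"
  shows "bounded_clinear (weighted_shift S)"
proof -
  note comp = component_weighted_shift[OF S]
  have comp_0: "component (weighted_shift S h) 0 = 0"
    and comp_Suc: "component (weighted_shift S h) (Suc n) = S (Suc n) (component h n)" for h n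
    by (simp_all add: comp)
  have lin: "bounded_clinear (S (Suc n))" for n using S by (simp add: bounded_weights_def)
  obtain M where M: "\<And>j. j \<ge> 1 \<Longrightarrow> onorm (S j) \<le> M"
    using S by (auto simp: bounded_weights_def bdd_above_def)
  have M0: "M \<ge> 0" using onorm_pos_le[OF bounded_clinearD(1)[OF lin[of 0]]] M[of 1] by simp
  have S_le: "norm (S (Suc n) x) \<le> M * norm x" for n x
    using M[of "Suc n"]
    by (intro order_trans[OF onorm[OF bounded_clinearD(1)[OF lin]] mult_right_mono]) auto
  have add: "S (Suc n) (x + y) = S (Suc n) x + S (Suc n) y" for n x y
    using linear_add[OF bounded_linear.linear[OF bounded_clinearD(1)[OF lin]]] .
  have scaleR: "S (Suc n) (r *\<^sub>R x) = r *\<^sub>R S (Suc n) x" for n r x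
    using linear_scale[OF bounded_linear.linear[OF bounded_clinearD(1)[OF lin]]] .
  show ?thesis
    unfolding bounded_clinear_def
  proof (intro conjI allI bounded_linear_intro)
    fix f g :: "'a ell2" and r a
    show "weighted_shift S (f + g) = weighted_shift S f + weighted_shift S g"
      by (simp add: component_inject[symmetric] fun_eq_iff comp plus_ell2.rep_eq add split: nat.split)
    show "weighted_shift S (r *\<^sub>R f) = r *\<^sub>R weighted_shift S f"
      by (simp add: component_inject[symmetric] fun_eq_iff comp scaleR_ell2.rep_eq scaleR split: nat.split)
    show "weighted_shift S (a *\<^sub>C f) = a *\<^sub>C weighted_shift S f"
      by (simp add: component_inject[symmetric] fun_eq_iff comp scaleC_ell2.rep_eq
          bounded_clinearD(2)[OF lin] linear_0[OF linear_scaleC] split: nat.split)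
    have "(norm (weighted_shift S f))\<^sup>2 = (\<Sum>i. (norm (S (Suc i) (component f i)))\<^sup>2)"
      using suminf_split_head[OF summable_component[of "weighted_shift S f"]]
      unfolding norm_ell2_sq by (simp add: comp_0 comp_Suc)
    also have "\<dots> \<le> (\<Sum>i. M\<^sup>2 * (norm (component f i))\<^sup>2)"
    proof (rule suminf_le)
      show "(norm (S (Suc i) (component f i)))\<^sup>2 \<le> M\<^sup>2 * (norm (component f i))\<^sup>2" for i
        using power_mono[OF S_le norm_ge_zero, of i "component f i" 2] by (simp add: power_mult_distrib)
      show "summable (\<lambda>i. (norm (S (Suc i) (component f i)))\<^sup>2)"
        using summable_component[of "weighted_shift S f"]
        by (subst (asm) summable_Suc_iff[symmetric]) (simp add: comp)
    qed (intro summable_mult summable_component)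
    also have "\<dots> = (norm f * M)\<^sup>2"
      unfolding suminf_mult[OF summable_component] power_mult_distrib norm_ell2_sq
      by (rule mult.commute)
    finally show "norm (weighted_shift S f) \<le> norm f * M"
      by (rule power2_le_imp_le) (use M0 in simp)
  qed
qed

text \<open>In the coordinates \<open>u\<close> the weighted shift acts as the plain shift.\<close>

lemma component_weighted_shift_funpow:
  assumes S: "bounded_weights S"
    and P: "\<And>n x. P (Suc n) x = S (Suc n) (P n x)"
    and u: "\<And>i. component f i = P i (u i)"
  shows "component ((weighted_shift S ^^ k) f) i = (if i < k then 0 else P i (u (i - k)))"
proof (induction k arbitrary: i)
  case (Suc k)
  have "bounded_linear (S (Suc n))" for n
    using S by (simp add: bounded_weights_def bounded_clinear_def)
  then have "S (Suc n) 0 = 0" for n by (intro linear_0 bounded_linear.linear)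
  then show ?case
    by (auto simp: component_weighted_shift[OF S] Suc P split: nat.split)
qed (simp add: u)

text \<open>Surjectivity allows the components of \<open>f\<close> and \<open>g\<close> to be
  written as \<open>P i (u i)\<close> and \<open>P i (v i)\<close>. The defect paired with
  \<open>g\<close> is then a series whose \<open>i\<close>-th term is the \<open>M\<close>-th
  difference at \<open>i\<close> of \<open>inner (P n (u i)) (P n (v i))\<close> in
  \<open>n\<close>.\<close>

lemma m_isometric_weighted_shift:
  fixes S P :: "nat \<Rightarrow> 'a::chilbert_space \<Rightarrow> 'a"
  assumes S: "bounded_weights S"
    and P: "\<And>n x. P (Suc n) x = S (Suc n) (P n x)" and surj: "\<And>n. surj (P n)"
    and diff: "\<And>x y n. (forward_diff ^^ M) (\<lambda>n. inner (P n x) (P n y)) n = 0"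
  shows "m_isometric M (weighted_shift S)"
proof -
  let ?W = "weighted_shift S"
  let ?c = "\<lambda>k. of_nat (M choose k) * (-1) ^ (M - k) :: real"
  have W: "bounded_clinear ?W" using S by (rule bounded_clinear_weighted_shift)
  have zero: "(\<Sum>k\<le>M. (of_nat (M choose k) * (-1) ^ (M - k)) *\<^sub>C (cadjoint ?W ^^ k) ((?W ^^ k) f)) = 0"
    (is "?s = 0") for f
  proof -
    have "of_nat (M choose k) * (-1) ^ (M - k) = complex_of_real (?c k)" for k by simp
    then have s: "?s = (\<Sum>k\<le>M. ?c k *\<^sub>R (cadjoint ?W ^^ k) ((?W ^^ k) f))"
      by (simp only: scaleC_of_real)
    have "inner ?s g = 0" for g
    proof -
      define u v where "u i = inv (P i) (component f i)" and "v i = inv (P i) (component g i)" for i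
      then have u: "component f i = P i (u i)" and v: "component g i = P i (v i)" for i
        using surj by (simp_all add: surj_f_inv_f)
      define b where "b k i = inner (P (i + k) (u i)) (P (i + k) (v i))" for k i
      have b: "summable (b k) \<and> inner ((?W ^^ k) f) ((?W ^^ k) g) = (\<Sum>i. b k i)" for k
      proof -
        note cf = component_weighted_shift_funpow[where P = P and S = S and u = u, OF S P u]
          and cg = component_weighted_shift_funpow[where P = P and S = S and u = v, OF S P v]
        let ?i = "\<lambda>i. inner (component ((?W ^^ k) f) i) (component ((?W ^^ k) g) i)"
        have summ: "summable ?i" by (intro summable_sq_inner summable_component)
        \<comment> \<open>Reindexing drops the \<open>k\<close> leading zeros, so that for fixed
          \<open>i\<close> all powers involve the same \<open>u i\<close> and
          \<open>v i\<close>.\<close>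
        have b_eq: "b k = (\<lambda>i. ?i (i + k))" by (simp add: b_def cf cg fun_eq_iff)
        show ?thesis
        proof
          show "summable (b k)" unfolding b_eq using summ by (rule summable_ignore_initial_segment)
          show "inner ((?W ^^ k) f) ((?W ^^ k) g) = (\<Sum>i. b k i)"
            unfolding b_eq inner_ell2.rep_eq suminf_split_initial_segment[OF summ, of k] by (simp add: cf)
        qed
      qed
      have "inner ?s g = (\<Sum>k\<le>M. ?c k * (\<Sum>i. b k i))"
        unfolding s using b by (simp add: inner_sum_left inner_cadjoint_funpow[OF W])
      also have "\<dots> = (\<Sum>k\<le>M. \<Sum>i. ?c k * b k i)"
        using b by (intro sum.cong refl suminf_mult[symmetric]) auto
      also have "\<dots> = (\<Sum>i. \<Sum>k\<le>M. ?c k * b k i)"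
        using b by (intro suminf_sum[symmetric] summable_mult) auto
      also have "\<dots> = 0"
        using diff by (simp add: b_def forward_diff_funpow)
      finally show ?thesis .
    qed
    from this[of ?s] show ?thesis by simp
  qed
  show ?thesis unfolding m_isometric_def by (rule conjI[OF W allI[OF zero]])
qed

section \<open>Interpolation of operator forms\<close>

primrec weight_product :: "(nat \<Rightarrow> 'a \<Rightarrow> 'a) \<Rightarrow> nat \<Rightarrow> 'a \<Rightarrow> 'a" where
  "weight_product A 0 = (\<lambda>x. x)"
| "weight_product A (Suc n) = (\<lambda>x. A (Suc n) (weight_product A n x))"

lemma invertible_op_id: "invertible_op (\<lambda>x. x)"
  unfolding invertible_op_def using bounded_clinear_id by (auto simp: fun_eq_iff intro!: exI[of _ "\<lambda>x. x"])

lemma invertible_op_compose: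
  assumes "invertible_op S" "invertible_op T"
  shows "invertible_op (\<lambda>x. S (T x))"
proof -
  obtain S' T' where S: "bounded_clinear S" "bounded_clinear S'" "S' \<circ> S = id" "S \<circ> S' = id"
    and T: "bounded_clinear T" "bounded_clinear T'" "T' \<circ> T = id" "T \<circ> T' = id"
    using assms unfolding invertible_op_def by blast
  have "(\<lambda>x. T' (S' x)) \<circ> (\<lambda>x. S (T x)) = id" "(\<lambda>x. S (T x)) \<circ> (\<lambda>x. T' (S' x)) = id"
    using S(3,4) T(3,4) by (simp_all add: fun_eq_iff)
  then show ?thesis
    unfolding invertible_op_def
    using bounded_clinear_compose[OF S(1) T(1)] bounded_clinear_compose[OF T(2) S(2)] by blast
qed

lemma invertible_op_weight_product:
  "(\<And>j. j \<ge> 1 \<Longrightarrow> invertible_op (A j)) \<Longrightarrow> invertible_op (weight_product A n)"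
  by (induction n) (auto intro: invertible_op_id invertible_op_compose)

lemma invertible_op_surj: "invertible_op T \<Longrightarrow> surj T"
  unfolding invertible_op_def surj_def by (metis comp_apply id_apply)

text \<open>The form \<open>\<langle>T\<^sub>n x, T\<^sub>n y\<rangle>\<close>, \<open>n \<le> m\<close>, is interpolated by Newton's formula with a polynomial of
  degree \<open>m\<close> in \<open>n\<close>; adding a large multiple of \<open>n choose (m + 1)\<close>, which vanishes for
  \<open>n \<le> m\<close> and dominates \<open>n choose j\<close> for \<open>j \<le> m < n\<close>, makes it coercive for \<open>n > m\<close>.\<close>

lemma newton_interpolation_forms:
  fixes T :: "nat \<Rightarrow> 'a::chilbert_space \<Rightarrow> 'a"
  assumes T: "\<And>n. bounded_clinear (T n)"
  obtains Q :: "nat \<Rightarrow> 'a \<Rightarrow> 'a" and K :: real where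
    "\<And>n. bounded_clinear (Q n)" "\<And>n x y. inner (Q n x) y = inner x (Q n y)"
    "\<And>n x y. n \<le> m \<Longrightarrow> inner (Q n x) y = inner (T n x) (T n y)"
    "\<And>n x y. (forward_diff ^^ (m + 2)) (\<lambda>n. inner (Q n x) y) n = 0"
    "\<And>n x. m < n \<Longrightarrow> (norm x)\<^sup>2 \<le> inner (Q n x) x"
    "\<And>n x. m < n \<Longrightarrow> inner (Q (Suc n) x) x \<le> K * inner (Q n x) x"
proof -
  \<comment> \<open>The Newton coefficients: \<open>j\<close>-th differences at 0 of the operators
    \<open>cadjoint (T k) \<circ> T k\<close>.\<close>
  define D where "D j x = (\<Sum>k\<le>j. (of_nat (j choose k) * (-1) ^ (j - k)) *\<^sub>R cadjoint (T k) (T k x))" for j x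
  have D: "bounded_clinear (D j)" for j
    unfolding D_def
    by (intro bounded_clinear_sum bounded_clinear_scaleR
        bounded_clinear_compose[OF bounded_clinear_cadjoint] T)
  have D_inner: "inner (D j x) y = (forward_diff ^^ j) (\<lambda>k. inner (T k x) (T k y)) 0" for j x y
    by (simp add: D_def forward_diff_funpow inner_sum_left inner_cadjoint_left[OF T])
  have D_sa: "inner (D j x) y = inner x (D j y)" for j x y
    unfolding inner_commute[of x "D j y"] D_inner by (simp add: inner_commute)
  define K0 where "K0 = (\<Sum>j\<le>m. onorm (D j))"
  have onorm_D: "0 \<le> onorm (D j)" for j by (rule onorm_pos_le[OF bounded_clinearD(1)[OF D]])
  have K0: "K0 \<ge> 0" unfolding K0_def by (intro sum_nonneg onorm_D)
  \<comment> \<open>The first summand absorbs all lower Newton terms when \<open>n > m\<close>; the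
    extra 1 is what remains for coercivity.\<close>
  define c where "c = 2 ^ Suc m * K0 + 1"
  have c: "c \<ge> 1" using K0 by (simp add: c_def)
  define Q where "Q n x = (\<Sum>j\<le>m. of_nat (n choose j) *\<^sub>R D j x) + (c * of_nat (n choose Suc m)) *\<^sub>R x" for n x
  have Q_inner: "inner (Q n x) y = (\<Sum>j\<le>m. of_nat (n choose j) * inner (D j x) y) + c * of_nat (n choose Suc m) * inner x y"
    for n x y by (simp add: Q_def inner_add_left inner_sum_left)
  have bound: "\<bar>\<Sum>j\<le>m. of_nat (n choose j) * inner (D j x) x\<bar> \<le> (c - 1) * of_nat (n choose Suc m) * (norm x)\<^sup>2"
    if "m < n" for n x
  proof -
    have D_le: "\<bar>inner (D j x) x\<bar> \<le> K0 * (norm x)\<^sup>2" if "j \<le> m" for j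
    proof -
      have "\<bar>inner (D j x) x\<bar> \<le> norm (D j x) * norm x" by (rule Cauchy_Schwarz_ineq2)
      also have "\<dots> \<le> onorm (D j) * norm x * norm x"
        by (intro mult_right_mono onorm bounded_clinearD(1)[OF D]) auto
      also have "\<dots> \<le> K0 * norm x * norm x"
        unfolding K0_def using that by (intro mult_right_mono member_le_sum onorm_D) auto
      finally show ?thesis by (simp add: power2_eq_square)
    qed
    have "\<bar>\<Sum>j\<le>m. of_nat (n choose j) * inner (D j x) x\<bar> \<le> (\<Sum>j\<le>m. of_nat (n choose j) * (K0 * (norm x)\<^sup>2))"
      by (intro order_trans[OF sum_abs] sum_mono) (simp add: abs_mult mult_left_mono D_le)
    also have "\<dots> = real (\<Sum>j\<le>m. n choose j) * (K0 * (norm x)\<^sup>2)" by (simp add: sum_distrib_right)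
    also have "\<dots> \<le> real (2 ^ Suc m * (n choose Suc m)) * (K0 * (norm x)\<^sup>2)"
      using K0 by (intro mult_right_mono of_nat_mono sum_binomial_le that) auto
    finally show ?thesis by (simp add: c_def ac_simps)
  qed
  have lower: "of_nat (n choose Suc m) * (norm x)\<^sup>2 \<le> inner (Q n x) x"
    and upper: "inner (Q n x) x \<le> 2 * c * of_nat (n choose Suc m) * (norm x)\<^sup>2" if "m < n" for n x
  proof -
    define w where "w = of_nat (n choose Suc m) * (norm x)\<^sup>2"
    have "w \<ge> 0" by (simp add: w_def)
    moreover have "inner (Q n x) x = (\<Sum>j\<le>m. of_nat (n choose j) * inner (D j x) x) + c * w"
      by (simp add: Q_inner w_def power2_norm_eq_inner)
    moreover have "\<bar>\<Sum>j\<le>m. of_nat (n choose j) * inner (D j x) x\<bar> \<le> c * w - w"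
      using bound[OF that, of x] by (simp add: w_def algebra_simps)
    ultimately have "w \<le> inner (Q n x) x \<and> inner (Q n x) x \<le> 2 * (c * w)" by linarith
    then show "of_nat (n choose Suc m) * (norm x)\<^sup>2 \<le> inner (Q n x) x"
      "inner (Q n x) x \<le> 2 * c * of_nat (n choose Suc m) * (norm x)\<^sup>2"
      by (simp_all add: w_def)
  qed
  \<comment> \<open>The constant is the upper factor \<open>2 * c\<close> times a bound on the ratio
    of \<open>Suc n choose Suc m\<close> to \<open>n choose Suc m\<close>, which Pascal's rule and
    \<open>sum_binomial_le\<close> provide.\<close>
  show thesis
  proof (rule that[of Q "2 * c * (2 ^ Suc m + 1)"])
    show "bounded_clinear (Q n)" for n
      unfolding Q_def
      by (intro bounded_clinear_add bounded_clinear_sum bounded_clinear_scaleR D bounded_clinear_id)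
    show "inner (Q n x) y = inner x (Q n y)" for n x y
      unfolding inner_commute[of x "Q n y"] Q_inner
      by (simp add: D_sa inner_commute[of y x]) (simp add: inner_commute[of x] D_sa)
    show "inner (Q n x) y = inner (T n x) (T n y)" if "n \<le> m" for n x y
    proof -
      \<comment> \<open>For \<open>n \<le> m\<close> the terms with \<open>j > n\<close> vanish, and
        so does the added leading term.\<close>
      have "inner (Q n x) y = (\<Sum>j\<le>n. of_nat (n choose j) * inner (D j x) y)"
        unfolding Q_inner using that by (simp add: binomial_eq_0)
          (intro sum.mono_neutral_right, auto simp: binomial_eq_0)
      then show ?thesis
        using newton_forward[of "\<lambda>k. inner (T k x) (T k y)" 0 n] by (simp add: D_inner)
    qed
    show "(forward_diff ^^ (m + 2)) (\<lambda>n. inner (Q n x) y) n = 0" for n x y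
    proof -
      define a where "a j = (if j \<le> m then inner (D j x) y else c * inner x y)" for j
      have "inner (Q n x) y = (\<Sum>j\<le>Suc m. a j * of_nat (n choose j))" for n
        by (simp add: Q_inner a_def ac_simps)
      then show ?thesis using forward_diff_newton_eq_0[of "Suc m" "m + 2"] by simp
    qed
    fix n and x :: 'a assume n: "m < n"
    have "1 \<le> n choose Suc m" using n by (simp add: Suc_le_eq)
    then have "1 * (norm x)\<^sup>2 \<le> of_nat (n choose Suc m) * (norm x)\<^sup>2"
      by (intro mult_right_mono) auto
    then show "(norm x)\<^sup>2 \<le> inner (Q n x) x" using lower[OF n, of x] by simp
    have "n choose m \<le> 2 ^ Suc m * (n choose Suc m)"
      by (rule order_trans[OF member_le_sum sum_binomial_le[OF n]]) auto
    then have "Suc n choose Suc m \<le> (2 ^ Suc m + 1) * (n choose Suc m)" by simp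
    then have "real (Suc n choose Suc m) \<le> real ((2 ^ Suc m + 1) * (n choose Suc m))"
      by (rule of_nat_mono)
    also have "\<dots> = (2 ^ Suc m + 1) * real (n choose Suc m)" by (simp add: algebra_simps)
    finally have le: "real (Suc n choose Suc m) \<le> (2 ^ Suc m + 1) * real (n choose Suc m)" .
    have "inner (Q (Suc n) x) x \<le> 2 * c * of_nat (Suc n choose Suc m) * (norm x)\<^sup>2"
      using n by (intro upper) simp
    also have "\<dots> \<le> 2 * c * ((2 ^ Suc m + 1) * real (n choose Suc m)) * (norm x)\<^sup>2"
      using c by (intro mult_right_mono mult_left_mono le) auto
    also have "\<dots> = 2 * c * (2 ^ Suc m + 1) * (of_nat (n choose Suc m) * (norm x)\<^sup>2)"
      by (simp only: ac_simps)
    also have "\<dots> \<le> 2 * c * (2 ^ Suc m + 1) * inner (Q n x) x"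
      by (rule mult_left_mono[OF lower[OF n]]) (use c in simp)
    finally show "inner (Q (Suc n) x) x \<le> 2 * c * (2 ^ Suc m + 1) * inner (Q n x) x" .
  qed
qed

section \<open>Recursive construction of the weights\<close>

theorem theorem3p9:
  fixes A :: "nat \<Rightarrow> 'a::chilbert_space \<Rightarrow> 'a" and m :: nat
  assumes "m \<ge> 1"
    and "\<And>j. j \<in> {1..m} \<Longrightarrow> invertible_op (A j)"
  shows "\<exists>S :: nat \<Rightarrow> 'a \<Rightarrow> 'a.
           bounded_weights S \<and>
           m_isometric (m + 2) (weighted_shift S) \<and>
           (\<forall>j\<in>{1..m}. S j = A j) \<and>
           (\<forall>j\<ge>m + 1. positive_op (S j))"
proof -
  \<comment> \<open>Padding by the identity makes every \<open>T n\<close> invertible; up to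
    \<open>m\<close> these are the products of the prescribed weights.\<close>
  define A' where "A' j = (if j \<in> {1..m} then A j else (\<lambda>x. x))" for j
  define T where "T = weight_product A'"
  have T: "invertible_op (T n)" for n
    unfolding T_def
    by (rule invertible_op_weight_product) (use assms(2) invertible_op_id in \<open>auto simp: A'_def\<close>)
  have T_bounded: "bounded_clinear (T n)" for n using T by (simp add: invertible_op_def)
  obtain Q K where Q: "\<And>n. bounded_clinear (Q n)" "\<And>n x y. inner (Q n x) y = inner x (Q n y)"
    and Q_T: "\<And>n x y. n \<le> m \<Longrightarrow> inner (Q n x) y = inner (T n x) (T n y)"
    and Q_diff: "\<And>n x y. (forward_diff ^^ (m + 2)) (\<lambda>n. inner (Q n x) y) n = 0"
    and Q_ge: "\<And>n x. m < n \<Longrightarrow> (norm x)\<^sup>2 \<le> inner (Q n x) x"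
    and Q_Suc: "\<And>n x. m < n \<Longrightarrow> inner (Q (Suc n) x) x \<le> K * inner (Q n x) x"
    by (rule newton_interpolation_forms[where T = T and m = m, OF T_bounded]) (rule that)
  \<comment> \<open>The state is the pair of the \<open>n\<close>-th weight and the
    \<open>n\<close>-th product. At 0 the weight is a dummy, later filled by
    \<open>id\<close>.\<close>
  let ?good = "\<lambda>n (p :: ('a \<Rightarrow> 'a) \<times> ('a \<Rightarrow> 'a)). invertible_op (snd p) \<and>
    (\<forall>x y. inner (snd p x) (snd p y) = inner (Q n x) y) \<and> (n \<le> m \<longrightarrow> snd p = T n)"
  let ?step = "\<lambda>n (p :: ('a \<Rightarrow> 'a) \<times> ('a \<Rightarrow> 'a)) (q :: ('a \<Rightarrow> 'a) \<times> ('a \<Rightarrow> 'a)).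
    snd q = (\<lambda>x. fst q (snd p x)) \<and>
    (if n < m then fst q = A (Suc n) else positive_op (fst q))"
  have "\<exists>f. \<forall>n. ?good n (f n) \<and> ?step n (f n) (f (Suc n))"
  proof (rule dependent_nat_choice)
    show "\<exists>p. ?good 0 p" using T[of 0] by (intro exI[of _ "(id, T 0)"]) (simp add: Q_T)
  next
    fix p n assume p: "?good n p"
    show "\<exists>q. ?good (Suc n) q \<and> ?step n p q"
    proof (cases "n < m")
      case True
      then have "T (Suc n) = (\<lambda>x. A (Suc n) (T n x))" by (simp add: T_def A'_def)
      with True p T[of "Suc n"] show ?thesis
        by (intro exI[of _ "(A (Suc n), T (Suc n))"]) (simp add: Q_T)
    next
      case False
      \<comment> \<open>From \<open>n \<ge> m\<close> the next index exceeds \<open>m\<close>, so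
        the form to be factored is coercive with constant 1.\<close>
      then have le: "1 * (norm x)\<^sup>2 \<le> inner (Q (Suc n) x) x" for x using Q_ge by simp
      have inv: "invertible_op (snd p)" using p by blast
      obtain R where R: "positive_op R" "invertible_op R"
        "\<And>x y. inner (R (snd p x)) (R (snd p y)) = inner (Q (Suc n) x) y"
        by (rule positive_factor_exists[OF inv Q(1) Q(2) zero_less_one le]) (rule that)
      with False show ?thesis
        by (intro exI[of _ "(R, \<lambda>x. R (snd p x))"]) (simp add: invertible_op_compose[OF R(2) inv])
    qed
  qed
  then obtain f where f: "\<And>n. ?good n (f n)" and step: "\<And>n. ?step n (f n) (f (Suc n))" by auto
  define S where "S n = fst (f n)" for n
  define P where "P n = snd (f n)" for n
  have P: "invertible_op (P n)" "inner (P n x) (P n y) = inner (Q n x) y"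
    "P (Suc n) x = S (Suc n) (P n x)" for n x y
    using f[of n] step[of n] by (simp_all add: P_def S_def)
  have S_A: "\<forall>j\<in>{1..m}. S j = A j"
  proof
    fix j assume "j \<in> {1..m}"
    then show "S j = A j" using step[of "j - 1"] by (cases j) (simp_all add: S_def)
  qed
  have S_pos: "\<forall>j\<ge>m + 1. positive_op (S j)"
  proof (intro allI impI)
    fix j assume "j \<ge> m + 1"
    then show "positive_op (S j)" using step[of "j - 1"] by (cases j) (simp_all add: S_def)
  qed
  have S: "bounded_clinear (S j)" if "j \<ge> 1" for j
    using S_A S_pos assms(2)[of j] that by (cases "j \<le> m") (auto simp: positive_op_def invertible_op_def)
  \<comment> \<open>The comparison of consecutive forms starts at index \<open>m + 1\<close>, hence
    bounds weights from \<open>m + 2\<close> on; the earlier ones form a finite set. The absolute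
    value is there because \<open>K\<close> comes with no sign.\<close>
  have S_le: "onorm (S j) \<le> sqrt \<bar>K\<bar>" if j: "j \<ge> m + 2" for j
  proof (rule onorm_bound)
    fix y
    obtain n where n: "j = Suc n" "m < n" using j by (cases j) auto
    obtain x where y: "y = P n x" using invertible_op_surj[OF P(1)[of n]] by auto
    have "(norm (S j y))\<^sup>2 = inner (Q (Suc n) x) x"
      by (simp add: n y power2_norm_eq_inner P(2) flip: P(3))
    also have "\<dots> \<le> K * inner (Q n x) x" by (rule Q_Suc[OF n(2)])
    also have "\<dots> = K * (norm y)\<^sup>2" by (simp add: y power2_norm_eq_inner P(2))
    also have "\<dots> \<le> \<bar>K\<bar> * (norm y)\<^sup>2" by (intro mult_right_mono) auto
    also have "\<dots> = (sqrt \<bar>K\<bar> * norm y)\<^sup>2" by (simp add: power_mult_distrib)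
    finally show "norm (S j y) \<le> sqrt \<bar>K\<bar> * norm y" by (rule power2_le_imp_le) simp
  qed simp
  have "bounded_weights S"
    unfolding bounded_weights_def
  proof (intro conjI allI impI S)
    let ?n = "\<lambda>j. onorm (S j)"
    have "bdd_above (?n ` {..m + 1})" by (rule bdd_above_finite) simp
    moreover have "bdd_above (?n ` {m + 2..})" by (rule bdd_aboveI2[OF S_le]) simp
    ultimately have "bdd_above (?n ` {..m + 1} \<union> ?n ` {m + 2..})" by simp
    moreover have "?n ` {1..} \<subseteq> ?n ` {..m + 1} \<union> ?n ` {m + 2..}"
      unfolding image_Un[symmetric] by (rule image_mono) auto
    ultimately show "bdd_above (?n ` {1..})" by (rule bdd_above_mono)
  qed
  moreover from this have "m_isometric (m + 2) (weighted_shift S)"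
    using P(3) invertible_op_surj[OF P(1)] Q_diff
    by (intro m_isometric_weighted_shift[where P = P]) (simp_all add: P(2))
  ultimately show ?thesis using S_A S_pos by blast
qed

end
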